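(* For $s,t\in\mathbb{C}$ with $\mathrm{Re}(s)>1$ and $\mathrm{Re}(t)>1$, we have $$\zeta(s)\zeta(t)=\sum_{k=0}^{\infty}\left[\binom{t+k-1}{k}\zeta_2(s-k,t+k)-\binom{s+t+k-1}{s+k}\zeta_2(-k,s+t+k)\right]+\sum_{k=0}^{\infty}\left[\binom{s+k-1}{k}\zeta_2(t-k,s+k)-\binom{s+t+k-1}{t+k}\zeta_2(-k,s+t+k)\right].$$
   Context: $\zeta$ is the Riemann zeta function and $\zeta_2(s_1,s_2)=\sum_{0<n_1<n_2}n_1^{-s_1}n_2^{-s_2}=\sum_{m,n\ge1}m^{-s_1}(m+n)^{-s_2}$ is the double zeta function, absolutely convergent for $\mathrm{Re}(s_2)>1$ and $\mathrm{Re}(s_1+s_2)>2$. The generalized binomial coefficient is $\binom{s}{t}=\dfrac{\Gamma(s+1)}{\Gamma(t+1)\Gamma(s-t+1)}$ for complex $s,t$. *)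

theory Defs
  imports "HOL-Analysis.Analysis"
begin

text \<open>
  Both zeta functions are given by their Dirichlet series, so they have their usual meaning only
  in the domain of absolute convergence (\<open>Re s > 1\<close>, respectively \<open>Re s2 > 1\<close> and
  \<open>Re (s1 + s2) > 2\<close>); elsewhere they need not agree with the analytic continuation.
\<close>

definition zeta :: "complex \<Rightarrow> complex" where
  "zeta s = (\<Sum>\<^sub>\<infinity>n\<in>{1::nat..}. of_nat n powr (- s))"

definition zeta2 :: "complex \<Rightarrow> complex \<Rightarrow> complex" where
  "zeta2 s1 s2 =
     (\<Sum>\<^sub>\<infinity>(n1, n2)\<in>{(n1::nat, n2::nat). 0 < n1 \<and> n1 < n2}.
        of_nat n1 powr (- s1) * of_nat n2 powr (- s2))"

text \<open>
  \<^const>\<open>Gamma\<close> is \<open>0\<close> at its poles and \<open>x / 0 = 0\<close>, so the quotient vanishes when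
  a Gamma factor of the denominator has a pole, in accordance with \<open>1 / \<Gamma>\<close> being entire.
  When \<open>s + 1\<close> is a pole of the numerator the value is the junk value \<open>0\<close>.
\<close>

definition cbinomial :: "complex \<Rightarrow> complex \<Rightarrow> complex" where
  "cbinomial s t = Gamma (s + 1) / (Gamma (t + 1) * Gamma (s - t + 1))"

end

theory Submission
  imports Defs
begin

text \<open>
  Expanding \<open>(1 - m/n) powr (- t)\<close> binomially in
  \<open>\<zeta>(s) \<zeta>(t) = (\<Sum>0<m<n. m powr (- s) * (n - m) powr (- t))\<close> shows that the first binomial terms of
  either series already sum to \<open>\<zeta>(s) \<zeta>(t)\<close>. The subtracted terms sum to
  \<open>(\<Sum>0<m<n. n powr (- s - t) * F s t (m/n))\<close> with
  \<open>F s t x = (\<Sum>k. \<Gamma>(s + t + k) / (\<Gamma>(s + k + 1) \<Gamma>(t)) * x ^ k)\<close>, and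
  \<open>x powr s * (1 - x) powr t * F s t x\<close> is the regularized incomplete beta function \<open>I\<^sub>x(s,t)\<close>.
  The reflection formula \<open>I\<^sub>x(s,t) + I\<^bsub>1-x\<^esub>(t,s) = 1\<close>, applied at \<open>x = m/n\<close>, shows that the
  subtracted terms of both series together again sum to \<open>\<zeta>(s) \<zeta>(t)\<close>. All interchanges are
  justified by bounding the coefficients by those of \<open>(1 - x) powr (- Re t)\<close>.
\<close>

section \<open>Binomial series and the growth of rising factorials\<close>

lemma Re_pos_imp_not_nonpos_Int: "Re z > 0 \<Longrightarrow> z \<notin> \<int>\<^sub>\<le>\<^sub>0"
  by (auto elim!: nonpos_Ints_cases)

lemma pochhammer_series_sums_complex:
  fixes z :: complex
  assumes "norm z < 1"
  shows "(\<lambda>k. pochhammer a k / fact k * z ^ k) sums (1 - z) powr (- a)"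
proof -
  have "((- a) gchoose k) * (- z) ^ k = pochhammer a k / fact k * z ^ k" for k
    by (simp add: gbinomial_pochhammer power_minus[of z] field_simps)
  with gen_binomial_complex[of "- z" "- a"] assms show ?thesis by simp
qed

lemma pochhammer_series_sums_real:
  fixes x :: real
  assumes "\<bar>x\<bar> < 1"
  shows "(\<lambda>k. pochhammer a k / fact k * x ^ k) sums (1 - x) powr (- a)"
proof -
  have "((- a) gchoose k) * (- x) ^ k = pochhammer a k / fact k * x ^ k" for k
    by (simp add: gbinomial_pochhammer power_minus[of x] field_simps)
  with gen_binomial_real[of "- x" "- a"] assms show ?thesis by simp
qed

text \<open>In Euler's limit for Gamma the power of \<open>k\<close> at \<open>t\<close> has the
  same modulus as the one at \<open>Re t\<close>. The quotient of the approximants is therefore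
  exactly the ratio of the two sides, which converges and hence is bounded.\<close>

lemma pochhammer_norm_le:
  fixes t :: complex
  assumes "Re t > 0"
  obtains C where "C > 0" "\<And>k. norm (pochhammer t k) \<le> C * pochhammer (Re t) k"
proof -
  let ?f = "\<lambda>k. norm (pochhammer t k) / pochhammer (Re t) k"
  have pos: "pochhammer (Re t) k > 0" for k
    using assms by (rule pochhammer_pos)
  have "t \<notin> \<int>\<^sub>\<le>\<^sub>0" using assms by (rule Re_pos_imp_not_nonpos_Int)
  hence nz: "Gamma t \<noteq> 0" by (simp add: Gamma_eq_zero_iff)
  have "(\<lambda>k. Gamma_series' (Re t) k / norm (Gamma_series' t k)) \<longlonglongrightarrow> Gamma (Re t) / norm (Gamma t)"
    by (intro tendsto_intros Gamma_series'_LIMSEQ) (use nz in auto)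
  moreover have "Gamma_series' (Re t) k / norm (Gamma_series' t k) = ?f k" for k
    by (simp add: Gamma_series'_def norm_divide norm_mult norm_power field_simps)
  ultimately have "?f \<longlonglongrightarrow> Gamma (Re t) / norm (Gamma t)" by simp
  hence "Bseq ?f" by (intro convergent_imp_Bseq convergentI)
  then obtain C where C: "C > 0" "\<And>k. norm (?f k) \<le> C" by (auto elim: BseqE)
  show ?thesis
  proof (rule that[OF C(1)])
    fix k show "norm (pochhammer t k) \<le> C * pochhammer (Re t) k"
      using C(2)[of k] pos[of k] by (simp add: field_simps)
  qed
qed

section \<open>Power series of the incomplete beta function\<close>

text \<open>These are the binomials of the subtracted terms. At \<open>s = 0\<close> the formula
  would reduce to the coefficient \<open>pochhammer t k / fact k\<close> of
  \<open>(1 - z) powr (- t)\<close>, to which it is compared below.\<close>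

definition incbeta_coeff :: "complex \<Rightarrow> complex \<Rightarrow> nat \<Rightarrow> complex" where
  "incbeta_coeff s t k = Gamma (s + t + of_nat k) / (Gamma (s + of_nat k + 1) * Gamma t)"

definition incbeta_series :: "complex \<Rightarrow> complex \<Rightarrow> complex \<Rightarrow> complex" where
  "incbeta_series s t z = (\<Sum>k. incbeta_coeff s t k * z ^ k)"

text \<open>The functional equation of Gamma in numerator and denominator gives this first-order
  recurrence, the source of the differential equation for \<open>incbeta_series\<close>.\<close>

lemma incbeta_coeff_Suc:
  assumes "Re s > 0" "Re t > 0"
  shows "(s + of_nat k + 1) * incbeta_coeff s t (Suc k) = (s + t + of_nat k) * incbeta_coeff s t k"
proof -
  have 1: "s + t + of_nat k \<notin> \<int>\<^sub>\<le>\<^sub>0" "s + of_nat k + 1 \<notin> \<int>\<^sub>\<le>\<^sub>0"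
    using assms by (intro Re_pos_imp_not_nonpos_Int; simp)+
  have 2: "Gamma (s + t + of_nat (Suc k)) = (s + t + of_nat k) * Gamma (s + t + of_nat k)"
    "Gamma (s + of_nat (Suc k) + 1) = (s + of_nat k + 1) * Gamma (s + of_nat k + 1)"
    using Gamma_plus1[OF 1(1)] Gamma_plus1[OF 1(2)] by (simp_all add: algebra_simps)
  have "s + of_nat k + 1 \<noteq> 0" using 1(2) by auto
  thus ?thesis unfolding incbeta_coeff_def 2 by simp
qed

text \<open>Up to a constant the ratio is a quotient of Euler approximants at \<open>s + 1\<close>
  and \<open>t\<close> over those at \<open>s + t\<close> and \<open>1\<close>. Both pairs have the
  same sum, so the powers of \<open>k\<close> cancel, and the Gamma limits cancel the
  constant.\<close>

lemma incbeta_coeff_ratio_tendsto: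
  assumes "Re s > 0" "Re t > 0"
  shows "(\<lambda>k. incbeta_coeff s t k / (pochhammer t k / fact k)) \<longlonglongrightarrow> 1"
proof -
  have ni: "s + t \<notin> \<int>\<^sub>\<le>\<^sub>0" "s + 1 \<notin> \<int>\<^sub>\<le>\<^sub>0" "t \<notin> \<int>\<^sub>\<le>\<^sub>0" "1 \<notin> (\<int>\<^sub>\<le>\<^sub>0 :: complex set)"
    using assms by (intro Re_pos_imp_not_nonpos_Int; simp)+
  hence nz: "Gamma (s + t) \<noteq> 0" "Gamma (s + 1) \<noteq> 0" "Gamma t \<noteq> 0"
    by (simp_all add: Gamma_eq_zero_iff)
  have ph: "pochhammer (s + t) k \<noteq> 0" "pochhammer (s + 1) k \<noteq> 0" "pochhammer t k \<noteq> 0" for k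
    using ni by (auto simp: pochhammer_eq_0_iff)
  define q where "q k = Gamma (s + t) / (Gamma (s + 1) * Gamma t) *
      (Gamma_series' (s + 1) k * Gamma_series' t k / (Gamma_series' (s + t) k * Gamma_series' 1 k))" for k
  have "q \<longlonglongrightarrow> Gamma (s + t) / (Gamma (s + 1) * Gamma t) *
      (Gamma (s + 1) * Gamma t / (Gamma (s + t) * Gamma 1))"
    unfolding q_def by (intro tendsto_intros Gamma_series'_LIMSEQ) (use nz in auto)
  hence "q \<longlonglongrightarrow> 1" using nz by simp
  moreover have "q = (\<lambda>k. incbeta_coeff s t k / (pochhammer t k / fact k))"
  proof
    fix k
    have G: "Gamma (s + t + of_nat k) = Gamma (s + t) * pochhammer (s + t) k"
      "Gamma (s + of_nat k + 1) = Gamma (s + 1) * pochhammer (s + 1) k"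
      using pochhammer_Gamma[OF ni(1), of k] pochhammer_Gamma[OF ni(2), of k] nz
      by (simp_all add: field_simps)
    show "q k = incbeta_coeff s t k / (pochhammer t k / fact k)" unfolding incbeta_coeff_def G q_def Gamma_series'_def pochhammer_fact
      using nz ph[of k]
      by (simp add: field_simps pochhammer_fact[symmetric] exp_add)
  qed
  ultimately show ?thesis by simp
qed

lemma incbeta_coeff_bound:
  assumes "Re s > 0" "Re t > 0"
  obtains C where "C > 0" "\<And>k. norm (incbeta_coeff s t k) \<le> C * (pochhammer (Re t) k / fact k)"
proof -
  from assms have "t \<notin> \<int>\<^sub>\<le>\<^sub>0" by (intro Re_pos_imp_not_nonpos_Int)
  hence ph: "pochhammer t k \<noteq> 0" for k by (auto simp: pochhammer_eq_0_iff)
  obtain C where C: "C > 0" "\<And>k. norm (pochhammer t k) \<le> C * pochhammer (Re t) k"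
    using pochhammer_norm_le[OF assms(2)] by blast
  have "Bseq (\<lambda>k. incbeta_coeff s t k / (pochhammer t k / fact k))"
    using incbeta_coeff_ratio_tendsto[OF assms] by (intro convergent_imp_Bseq convergentI)
  then obtain D where D: "D > 0" "\<And>k. norm (incbeta_coeff s t k / (pochhammer t k / fact k)) \<le> D"
    by (auto elim: BseqE)
  show ?thesis
  proof (rule that[of "D * C"])
    fix k
    have "norm (incbeta_coeff s t k) = 
        norm (incbeta_coeff s t k / (pochhammer t k / fact k)) * norm (pochhammer t k / fact k)"
      unfolding norm_mult [symmetric] using ph[of k] by simp
    also have "\<dots> \<le> D * (C * pochhammer (Re t) k / fact k)"
      using C D by (intro mult_mono) (auto simp: norm_divide intro!: divide_right_mono)
    finally show "norm (incbeta_coeff s t k) \<le> D * C * (pochhammer (Re t) k / fact k)" by simp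
  qed (use C D in auto)
qed

text \<open>The majorant is the real binomial series at \<open>norm z\<close>. Its closed form is
  what makes the later summation over pairs possible.\<close>

lemma summable_norm_pochhammer_bound:
  fixes a :: "nat \<Rightarrow> complex"
  assumes a: "\<And>k. norm (a k) \<le> C * (pochhammer \<tau> k / fact k)" and z: "norm z < 1"
  shows "summable (\<lambda>k. norm (a k * z ^ k))"
    and "(\<Sum>k. norm (a k * z ^ k)) \<le> C * (1 - norm z) powr (- \<tau>)"
proof -
  have S: "(\<lambda>k. C * (pochhammer \<tau> k / fact k * norm z ^ k)) sums (C * (1 - norm z) powr (- \<tau>))"
    using pochhammer_series_sums_real[of "norm z" \<tau>] z by (intro sums_mult) auto
  have le: "norm (a k * z ^ k) \<le> C * (pochhammer \<tau> k / fact k * norm z ^ k)" for k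
    using mult_right_mono[OF a[of k], of "norm z ^ k"] by (simp add: norm_mult norm_power mult_ac)
  show sm: "summable (\<lambda>k. norm (a k * z ^ k))"
    by (rule summable_comparison_test[OF _ sums_summable[OF S]]) (use le in auto)
  show "(\<Sum>k. norm (a k * z ^ k)) \<le> C * (1 - norm z) powr (- \<tau>)"
    using suminf_le[OF le sm sums_summable[OF S]] sums_unique[OF S] by simp
qed

section \<open>Boundary behaviour at 1\<close>

text \<open>Coefficients that are small relative to those of \<open>(1 - x) powr (- \<tau>)\<close>
  give a sum small relative to that function: finitely many terms stay bounded and are killed by
  \<open>(1 - x) powr \<tau>\<close>, and the tail is at most \<epsilon>/2 times the full binomial
  series.\<close>

lemma abelian_tendsto_0:
  fixes d :: "nat \<Rightarrow> complex" and e :: "nat \<Rightarrow> real"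
  assumes "\<tau> > 0" and e: "e \<longlonglongrightarrow> 0"
    and d: "\<And>k. norm (d k) \<le> e k * (pochhammer \<tau> k / fact k)"
  shows "((\<lambda>x::real. (1 - x) powr \<tau> * norm (\<Sum>k. d k * of_real x ^ k)) \<longlongrightarrow> 0) (at_left 1)"
proof (rule tendstoI)
  fix \<epsilon> :: real assume \<epsilon>: "\<epsilon> > 0"
  let ?\<alpha> = "\<lambda>k. pochhammer \<tau> k / fact k"
  have \<alpha>: "?\<alpha> k > 0" for k using assms(1) by (simp add: pochhammer_pos)
  have e0: "e k \<ge> 0" for k
    using order_trans[OF norm_ge_zero d[of k]] \<alpha>[of k] zero_le_mult_iff[of "e k" "?\<alpha> k"] by linarith
  from order_tendstoD(2)[OF e, of "\<epsilon>/2"] \<epsilon> obtain N where N: "\<And>k. k \<ge> N \<Longrightarrow> e k < \<epsilon> / 2"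
    by (auto simp: eventually_at_top_linorder)
  define M where "M = (\<Sum>k<N. e k * ?\<alpha> k)"
  have "((\<lambda>x::real. M * (1 - x) powr \<tau>) \<longlongrightarrow> M * (1 - 1) powr \<tau>) (at_left 1)"
    using assms(1) by (intro tendsto_intros) (auto simp: eventually_at_filter)
  hence "((\<lambda>x::real. M * (1 - x) powr \<tau>) \<longlongrightarrow> 0) (at_left 1)" by simp
  hence 1: "\<forall>\<^sub>F x in at_left (1::real). M * (1 - x) powr \<tau> < \<epsilon> / 2"
    using \<epsilon> by (intro order_tendstoD(2)[where a = "\<epsilon> / 2"]) auto
  have 2: "\<forall>\<^sub>F x in at_left (1::real). x \<in> {0<..<1}"
    by (rule eventually_at_left_real) simp
  show "\<forall>\<^sub>F x in at_left (1::real).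
      dist ((1 - x) powr \<tau> * norm (\<Sum>k. d k * of_real x ^ k)) 0 < \<epsilon>"
    using 1 2
  proof eventually_elim
    case (elim x)
    hence x: "0 < x" "x < 1" by auto
    \<comment> \<open>The \<epsilon>/2 term is included for every \<open>k\<close>, not only for the
      tail, so that its sum has a closed form.\<close>
    let ?g = "\<lambda>k. (if k < N then e k * ?\<alpha> k else 0) + \<epsilon> / 2 * (?\<alpha> k * x ^ k)"
    have g: "?g sums (M + \<epsilon> / 2 * (1 - x) powr (-\<tau>))" unfolding M_def
      using sums_If_finite[of "\<lambda>k. k < N" "\<lambda>k. e k * ?\<alpha> k"] pochhammer_series_sums_real[of x \<tau>] x
      by (intro sums_add sums_mult) (auto simp: lessThan_def)
    have le: "norm (d k * of_real x ^ k) \<le> ?g k" for k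
    proof -
      have "norm (d k * of_real x ^ k) \<le> e k * ?\<alpha> k * x ^ k"
        using mult_right_mono[OF d[of k], of "x ^ k"] x by (simp add: norm_mult norm_power)
      also have "\<dots> \<le> ?g k"
      proof (cases "k < N")
        case True
        have "e k * ?\<alpha> k * x ^ k \<le> e k * ?\<alpha> k * 1"
          using e0[of k] less_imp_le[OF \<alpha>[of k]] x by (intro mult_left_mono power_le_one mult_nonneg_nonneg) auto
        moreover have "\<epsilon> / 2 * (?\<alpha> k * x ^ k) \<ge> 0"
          using \<epsilon> \<alpha>[of k] x by (intro mult_nonneg_nonneg) auto
        ultimately show ?thesis using True by simp
      next
        case False
        have "e k * (?\<alpha> k * x ^ k) \<le> \<epsilon> / 2 * (?\<alpha> k * x ^ k)"
          using N[of k] False \<alpha>[of k] x by (intro mult_right_mono mult_nonneg_nonneg) auto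
        thus ?thesis using False by simp
      qed
      finally show ?thesis .
    qed
    have "norm (\<Sum>k. d k * of_real x ^ k) \<le> M + \<epsilon> / 2 * (1 - x) powr (-\<tau>)"
      using norm_suminf_le[OF le sums_summable[OF g]] sums_unique[OF g] by simp
    hence "(1 - x) powr \<tau> * norm (\<Sum>k. d k * of_real x ^ k) \<le>
        (1 - x) powr \<tau> * (M + \<epsilon> / 2 * (1 - x) powr (-\<tau>))"
      by (intro mult_left_mono) auto
    also have "\<dots> = M * (1 - x) powr \<tau> + \<epsilon> / 2"
      using x by (simp add: powr_minus field_simps)
    also have "\<dots> < \<epsilon>" using elim(1) by simp
    finally show ?case by simp
  qed
qed

text \<open>The limit is trivial for \<open>(1 - x) powr (- t)\<close> in place of the series. The
  coefficients of the difference are relatively small because the coefficient ratio tends to 1, so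
  the Abelian lemma applies.\<close>

lemma incbeta_series_tendsto_1:
  assumes "Re s > 0" "Re t > 0"
  shows "((\<lambda>x::real. of_real (1 - x) powr t * incbeta_series s t (of_real x)) \<longlongrightarrow> 1) (at_left 1)"
proof -
  from assms have "t \<notin> \<int>\<^sub>\<le>\<^sub>0" by (intro Re_pos_imp_not_nonpos_Int)
  hence ph: "pochhammer t k \<noteq> 0" for k by (auto simp: pochhammer_eq_0_iff)
  let ?a = "\<lambda>k. pochhammer t k / fact k" and ?b = "incbeta_coeff s t"
  obtain C where C: "C > 0" "\<And>k. norm (pochhammer t k) \<le> C * pochhammer (Re t) k"
    using pochhammer_norm_le[OF assms(2)] by blast
  obtain D where D: "\<And>k. norm (?b k) \<le> D * (pochhammer (Re t) k / fact k)"
    using incbeta_coeff_bound[OF assms] by blast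
  \<comment> \<open>The relative error of the coefficients; \<open>C\<close> pays for replacing
    \<open>pochhammer t k\<close> by \<open>pochhammer (Re t) k\<close>.\<close>
  define e where "e k = norm (?b k / ?a k - 1) * C" for k
  have e: "e \<longlonglongrightarrow> 0" unfolding e_def
    using tendsto_mult_left_zero[OF tendsto_norm_zero[OF LIM_zero[OF incbeta_coeff_ratio_tendsto[OF assms]]]]
    by simp
  have d: "norm (?b k - ?a k) \<le> e k * (pochhammer (Re t) k / fact k)" for k
  proof -
    have "?b k - ?a k = (?b k / ?a k - 1) * ?a k"
    proof -
      have "b - a = (b / a - 1) * a" if "a \<noteq> 0" for a b :: complex
        using that by (simp add: left_diff_distrib)
      thus ?thesis using ph[of k] by (metis divide_eq_0_iff fact_nonzero)
    qed
    hence "norm (?b k - ?a k) = norm (?b k / ?a k - 1) * norm (?a k)"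
      by (simp only: norm_mult)
    also have "\<dots> \<le> norm (?b k / ?a k - 1) * (C * pochhammer (Re t) k / fact k)"
      using C by (intro mult_left_mono) (auto simp: norm_divide intro!: divide_right_mono)
    finally show ?thesis by (simp add: e_def)
  qed
  have "((\<lambda>x::real. (1 - x) powr Re t * norm (\<Sum>k. (?b k - ?a k) * of_real x ^ k)) \<longlongrightarrow> 0) (at_left 1)"
    by (rule abelian_tendsto_0[OF assms(2) e d])
  moreover have "\<forall>\<^sub>F x in at_left (1::real). x \<in> {0<..<1}"
    by (rule eventually_at_left_real) simp
  hence "\<forall>\<^sub>F x in at_left (1::real). (1 - x) powr Re t * norm (\<Sum>k. (?b k - ?a k) * of_real x ^ k) =
      norm (of_real (1 - x) powr t * incbeta_series s t (of_real x) - 1)"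
  proof eventually_elim
    case (elim x)
    hence x: "norm (of_real x :: complex) < 1" by auto
    have A: "(\<lambda>k. ?a k * of_real x ^ k) sums (1 - of_real x) powr (- t)"
      using pochhammer_series_sums_complex[OF x] .
    have B: "(\<lambda>k. ?b k * of_real x ^ k) sums incbeta_series s t (of_real x)"
      unfolding incbeta_series_def
      using summable_norm_cancel[OF summable_norm_pochhammer_bound(1)[OF D x]] by (rule summable_sums)
    have "(\<Sum>k. (?b k - ?a k) * of_real x ^ k) = incbeta_series s t (of_real x) - (1 - of_real x) powr (- t)"
      using sums_unique[OF sums_diff[OF B A]] by (simp add: algebra_simps)
    moreover have "(1 - x) powr Re t = norm (of_real (1 - x) powr t :: complex)"
      using elim by (subst norm_powr_real_powr) auto
    moreover have "of_real (1 - x) powr t * (1 - of_real x) powr (- t) = (1 :: complex)"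
      using elim by (simp add: powr_minus)
    ultimately show ?case
      by (simp only: norm_mult[symmetric] right_diff_distrib)
  qed
  ultimately have "((\<lambda>x::real. norm (of_real (1 - x) powr t * incbeta_series s t (of_real x) - 1)) \<longlongrightarrow> 0) (at_left 1)"
    by (rule Lim_transform_eventually)
  thus ?thesis by (rule LIM_zero_cancel[OF tendsto_norm_zero_cancel])
qed


section \<open>Differential equation and reflection formula\<close>

lemma incbeta_series_sums:
  assumes "Re s > 0" "Re t > 0" "norm z < 1"
  shows "(\<lambda>k. incbeta_coeff s t k * z ^ k) sums incbeta_series s t z"
proof -
  obtain D where D: "\<And>k. norm (incbeta_coeff s t k) \<le> D * (pochhammer (Re t) k / fact k)"
    using incbeta_coeff_bound[OF assms(1,2)] by blast
  show ?thesis unfolding incbeta_series_def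
    using summable_norm_cancel[OF summable_norm_pochhammer_bound(1)[OF D assms(3)]] by (rule summable_sums)
qed

text \<open>The coefficient recurrence, multiplied by \<open>z ^ Suc k\<close> and summed. It
  expresses that \<open>z powr s * (1 - z) powr t * incbeta_series s t z\<close> has the normalized
  beta density \<open>z powr (s - 1) * (1 - z) powr (t - 1) / B(s,t)\<close> as derivative.\<close>

lemma incbeta_series_ode:
  assumes "Re s > 0" "Re t > 0" "norm z < 1"
  obtains F' where "(incbeta_series s t has_field_derivative F') (at z)"
    "(1 - z) * (s * incbeta_series s t z + z * F') - t * z * incbeta_series s t z
       = Gamma (s + t) / (Gamma s * Gamma t)"
proof
  let ?b = "incbeta_coeff s t" and ?F = "incbeta_series s t z"
  define F' where "F' = (\<Sum>k. diffs ?b k * z ^ k)"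
  have sm: "summable (\<lambda>k. ?b k * w ^ k)" if "norm w < 1" for w
    using incbeta_series_sums[OF assms(1,2) that] by (rule sums_summable)
  show "(incbeta_series s t has_field_derivative F') (at z)"
    unfolding incbeta_series_def[abs_def] F'_def using sm assms(3) by (rule termdiffs_strong')
  have "(\<lambda>k. diffs ?b k * z ^ k) sums F'"
    unfolding F'_def by (intro summable_sums termdiff_converges[OF assms(3)] sm)
  from sums_mult[OF this, of z] have "(\<lambda>k. of_nat (Suc k) * ?b (Suc k) * z ^ Suc k) sums (z * F')"
    by (simp add: diffs_def mult_ac)
  hence 1: "(\<lambda>k. of_nat k * ?b k * z ^ k) sums (z * F')"
    by (subst (asm) sums_Suc_iff) simp
  have F: "(\<lambda>k. ?b k * z ^ k) sums ?F"
    using incbeta_series_sums[OF assms] .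
  have H: "(\<lambda>k. (s + of_nat k) * ?b k * z ^ k) sums (s * ?F + z * F')"
    using sums_add[OF sums_mult[OF F, of s] 1] by (simp add: algebra_simps)
  \<comment> \<open>Splitting off the term at index 0 produces the inhomogeneous constant; the
    remaining terms are rewritten by the recurrence.\<close>
  have "(\<lambda>k. (s + of_nat (Suc k)) * ?b (Suc k) * z ^ Suc k) sums (s * ?F + z * F' - s * ?b 0)"
    using H by (subst sums_Suc_iff) simp
  moreover have "(\<lambda>k. (s + of_nat (Suc k)) * ?b (Suc k) * z ^ Suc k) =
      (\<lambda>k. z * (t * (?b k * z ^ k) + (s + of_nat k) * ?b k * z ^ k))"
  proof
    fix k
    show "(s + of_nat (Suc k)) * ?b (Suc k) * z ^ Suc k =
        z * (t * (?b k * z ^ k) + (s + of_nat k) * ?b k * z ^ k)"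
      using incbeta_coeff_Suc[OF assms(1,2), of k] by (simp add: add_ac) (simp add: algebra_simps)
  qed
  moreover have "\<dots> sums (z * (t * ?F + (s * ?F + z * F')))"
    using sums_mult[OF sums_add[OF sums_mult[OF F, of t] H], of z] .
  ultimately have rec: "s * ?F + z * F' - s * ?b 0 = z * (t * ?F + (s * ?F + z * F'))"
    by (simp only: sums_unique2)
  have b0: "s * ?b 0 = Gamma (s + t) / (Gamma s * Gamma t)"
  proof -
    have "s \<notin> \<int>\<^sub>\<le>\<^sub>0" using assms(1) by (rule Re_pos_imp_not_nonpos_Int)
    from Gamma_plus1[OF this] assms(1) show ?thesis by (auto simp: incbeta_coeff_def)
  qed
  have "(1 - z) * (s * ?F + z * F') - t * z * ?F =
      (s * ?F + z * F') - z * (t * ?F + (s * ?F + z * F'))"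
    by (simp add: algebra_simps)
  also have "\<dots> = s * ?b 0" unfolding rec[symmetric] by simp
  finally show "(1 - z) * (s * ?F + z * F') - t * z * ?F = Gamma (s + t) / (Gamma s * Gamma t)"
    unfolding b0 .
qed

text \<open>The modulus is a real power with exponent \<open>Re t > 0\<close>, so the limit reduces
  to a real one at the branch point 0.\<close>

lemma tendsto_of_real_powr_0:
  fixes f :: "'a \<Rightarrow> real"
  assumes "Re t > 0" "(f \<longlongrightarrow> 0) F" "\<forall>\<^sub>F x in F. f x \<ge> 0"
  shows "((\<lambda>x. of_real (f x) powr t :: complex) \<longlongrightarrow> 0) F"
proof (rule tendsto_norm_zero_cancel)
  have "((\<lambda>x. f x powr Re t) \<longlongrightarrow> 0 powr Re t) F"
    using assms by (intro tendsto_intros) auto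
  moreover have "\<forall>\<^sub>F x in F. f x powr Re t = norm (of_real (f x) powr t :: complex)"
    using assms(3) by eventually_elim (simp add: norm_powr_real_powr)
  ultimately show "((\<lambda>x. norm (of_real (f x) powr t :: complex)) \<longlongrightarrow> 0) F"
    using Lim_transform_eventually by fastforce
qed

text \<open>
  The left-hand side multiplied by \<open>x powr s * (1 - x) powr t\<close> has derivative \<open>0\<close>. Its constant value
  is read off as \<open>x\<close> tends to \<open>1\<close> by an Abelian theorem, which avoids the complex beta integral.
\<close>

lemma incbeta_reflection:
  fixes x :: real
  assumes s: "Re s > 0" and t: "Re t > 0" and x: "0 < x" "x < 1"
  shows "incbeta_series s t (of_real x) + incbeta_series t s (of_real (1 - x))
           = of_real x powr (- s) * of_real (1 - x) powr (- t)"
proof -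
  define \<Phi> where "\<Phi> z = z powr s * (1 - z) powr t * (incbeta_series s t z + incbeta_series t s (1 - z))" for z
  \<comment> \<open>In the open disc with diameter from 0 to 1 both \<open>z\<close> and
    \<open>1 - z\<close> have modulus below 1 and positive real part. Hence both series converge and
    both principal powers are holomorphic.\<close>
  define S where "S = ball (1 / 2 :: complex) (1 / 2)"
  have "\<exists>c. \<forall>z\<in>S. \<Phi> z = c"
  proof (rule has_field_derivative_zero_constant)
    show "convex S" by (simp add: S_def)
    fix z assume "z \<in> S"
    hence d: "norm (1 / 2 - z) < 1 / 2" by (simp add: S_def dist_norm)
    have "norm z \<le> norm (1 / 2 :: complex) + norm (1 / 2 - z)"
      using norm_triangle_ineq4[of "1 / 2" "1 / 2 - z"] by simp
    hence z1: "norm z < 1" using d by (simp add: norm_divide)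
    have "norm (1 - z) \<le> norm (1 / 2 :: complex) + norm (1 / 2 - z)"
      using norm_triangle_ineq[of "1 / 2" "1 / 2 - z"] by simp
    hence z2: "norm (1 - z) < 1" using d by (simp add: norm_divide)
    have Re: "Re z > 0" "Re (1 - z) > 0"
      using abs_Re_le_cmod[of "1 / 2 - z"] d by auto
    hence nz: "z \<noteq> 0" "1 - z \<noteq> 0" by auto
    have np: "z \<notin> \<real>\<^sub>\<le>\<^sub>0" "1 - z \<notin> \<real>\<^sub>\<le>\<^sub>0" using Re by (auto simp: complex_nonpos_Reals_iff)
    let ?F = "incbeta_series s t z" and ?G = "incbeta_series t s (1 - z)"
    let ?c = "Gamma (s + t) / (Gamma s * Gamma t)"
    obtain F' where F': "(incbeta_series s t has_field_derivative F') (at z)"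
      "(1 - z) * (s * ?F + z * F') - t * z * ?F = ?c"
      using incbeta_series_ode[OF s t z1] by blast
    \<comment> \<open>The equation with \<open>s\<close> and \<open>t\<close> exchanged, at
      \<open>1 - z\<close>. The constant \<open>?c\<close> is symmetric, so it is the same in both
      equations.\<close>
    obtain G' where G': "(incbeta_series t s has_field_derivative G') (at (1 - z))"
      "z * (t * ?G + (1 - z) * G') - s * (1 - z) * ?G = ?c"
      using incbeta_series_ode[OF t s z2] by (auto simp: add.commute mult.commute)
    have lin: "((\<lambda>z. 1 - z) has_field_derivative - 1) (at z)"
      by (auto intro!: derivative_eq_intros)
    have G'': "((\<lambda>z. incbeta_series t s (1 - z)) has_field_derivative - G') (at z)"
      using DERIV_chain2[where f = "incbeta_series t s", OF G'(1) lin] by simp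
    have P: "((\<lambda>z. z powr s) has_field_derivative s * z powr s / z) (at z)"
      using has_field_derivative_powr[OF np(1), of s] nz by (simp add: powr_diff)
    have Q: "((\<lambda>z. (1 - z) powr t) has_field_derivative - (t * (1 - z) powr t / (1 - z))) (at z)"
      using DERIV_chain2[where f = "\<lambda>z. z powr t", OF has_field_derivative_powr[OF np(2), of t] lin] nz
      by (simp add: powr_diff)
    \<comment> \<open>Extracts the common factor, with \<open>w\<close> standing for
      \<open>1 - z\<close> and \<open>P\<close>, \<open>Q\<close> for the two powers.\<close>
    have alg: "(s * P / z * Q + - (t * Q / w) * P) * X + Y * (P * Q) =
        P * Q / (z * w) * ((s * w - t * z) * X + Y * (z * w))"
      if "w \<noteq> 0" for P Q X Y w :: complex
      using nz(1) that by (simp add: field_simps)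
    have "(\<Phi> has_field_derivative
        (s * z powr s / z * (1 - z) powr t + - (t * (1 - z) powr t / (1 - z)) * z powr s) * (?F + ?G)
         + (F' + - G') * (z powr s * (1 - z) powr t)) (at z)"
      unfolding \<Phi>_def by (rule DERIV_mult[OF DERIV_mult[OF P Q] DERIV_add[OF F'(1) G'']])
    also have "(s * z powr s / z * (1 - z) powr t + - (t * (1 - z) powr t / (1 - z)) * z powr s) * (?F + ?G)
         + (F' + - G') * (z powr s * (1 - z) powr t) =
        z powr s * (1 - z) powr t / (z * (1 - z)) *
          ((s * (1 - z) - t * z) * (?F + ?G) + (F' - G') * (z * (1 - z)))"
      using alg[OF nz(2)] by simp
    \<comment> \<open>The bracket is the difference of the two differential equations, whose
      right-hand sides agree.\<close>
    also have "(s * (1 - z) - t * z) * (?F + ?G) + (F' - G') * (z * (1 - z)) =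
        ((1 - z) * (s * ?F + z * F') - t * z * ?F) - (z * (t * ?G + (1 - z) * G') - s * (1 - z) * ?G)"
      by (simp add: algebra_simps)
    also have "\<dots> = 0" unfolding F'(2) G'(2) by simp
    finally show "(\<Phi> has_field_derivative 0) (at z within S)"
      by (simp add: has_field_derivative_at_within)
  qed
  then obtain c where c: "\<And>z. z \<in> S \<Longrightarrow> \<Phi> z = c" by blast
  have in_S: "complex_of_real y \<in> S" if "0 < y" "y < 1" for y
  proof -
    have "norm (1 / 2 - complex_of_real y) = norm (complex_of_real (1 / 2 - y))" by simp
    also have "\<dots> = \<bar>1 / 2 - y\<bar>" by (rule norm_of_real)
    finally show ?thesis unfolding S_def using that by (simp only: mem_ball dist_norm)
  qed
  have c1: "c = 1"
  \<comment> \<open>As \<open>y\<close> tends to 1, the first series contributes 1 by the Abelian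
    limit. The second tends to its value at 0 and is annihilated by
    \<open>(1 - y) powr t\<close>.\<close>
  proof (rule tendsto_unique)
    have ev: "\<forall>\<^sub>F y in at_left (1::real). y \<in> {0<..<1}"
      by (rule eventually_at_left_real) simp
    show "((\<lambda>y::real. \<Phi> (of_real y)) \<longlongrightarrow> c) (at_left 1)"
      by (rule tendsto_eventually, rule eventually_mono[OF ev]) (use c in_S in auto)
    have G: "((\<lambda>y::real. incbeta_series t s (1 - of_real y)) \<longlongrightarrow> incbeta_series t s 0) (at_left 1)"
    proof (rule isCont_tendsto_compose[where g = "incbeta_series t s"])
      show "isCont (incbeta_series t s) 0"
        using incbeta_series_ode[OF t s, of 0] by (metis DERIV_isCont norm_zero zero_less_one)
      show "((\<lambda>y::real. 1 - of_real y :: complex) \<longlongrightarrow> 0) (at_left 1)"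
        by (rule tendsto_eq_intros refl | simp)+
    qed
    have Q: "((\<lambda>y::real. of_real (1 - y) powr t :: complex) \<longlongrightarrow> 0) (at_left 1)"
    proof (rule tendsto_of_real_powr_0[OF t])
      show "((\<lambda>y::real. 1 - y) \<longlongrightarrow> 0) (at_left 1)"
        by (rule tendsto_eq_intros refl | simp)+
      show "\<forall>\<^sub>F y in at_left (1::real). 1 - y \<ge> 0"
        by (rule eventually_mono[OF ev]) auto
    qed
    have P: "((\<lambda>y::real. of_real y powr s :: complex) \<longlongrightarrow> of_real 1 powr s) (at_left 1)"
      by (intro tendsto_intros) auto
    have "((\<lambda>y::real. of_real y powr s * (of_real (1 - y) powr t * incbeta_series s t (of_real y)) +
        of_real y powr s * (of_real (1 - y) powr t * incbeta_series t s (1 - of_real y)))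
        \<longlongrightarrow> of_real 1 powr s * 1 + of_real 1 powr s * (0 * incbeta_series t s 0)) (at_left 1)"
      by (intro tendsto_add tendsto_mult P Q G incbeta_series_tendsto_1 s t)
    thus "((\<lambda>y::real. \<Phi> (of_real y)) \<longlongrightarrow> 1) (at_left 1)"
      by (simp add: \<Phi>_def algebra_simps)
  qed auto
  have "\<Phi> (of_real x) = 1" using c[OF in_S[OF x]] c1 by simp
  thus ?thesis using x by (simp add: \<Phi>_def powr_minus field_simps)
qed


section \<open>Interchange of summation\<close>

text \<open>Fubini on \<open>D \<times> UNIV\<close>. Summing norms over \<open>k\<close> first
  costs at most \<open>C * (1 - norm (x i)) powr (- \<tau>)\<close>, so the hypothesis on
  \<open>w\<close> gives absolute summability of the double family.\<close>

lemma sums_power_series_interchange: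
  fixes a :: "nat \<Rightarrow> complex" and w x :: "'i \<Rightarrow> complex"
  assumes a: "\<And>k. norm (a k) \<le> C * (pochhammer \<tau> k / fact k)"
    and x: "\<And>i. i \<in> D \<Longrightarrow> norm (x i) < 1"
    and w: "(\<lambda>i. norm (w i) * (1 - norm (x i)) powr (- \<tau>)) summable_on D"
  shows "(\<lambda>i. w i * (\<Sum>k. a k * x i ^ k)) summable_on D"
    and "(\<lambda>k. a k * (\<Sum>\<^sub>\<infinity>i\<in>D. w i * x i ^ k)) sums (\<Sum>\<^sub>\<infinity>i\<in>D. w i * (\<Sum>k. a k * x i ^ k))"
proof -
  define f where "f = (\<lambda>(i, k). w i * (a k * x i ^ k))"
  have sm: "summable (\<lambda>k. norm (a k * x i ^ k))" if "i \<in> D" for i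
    using summable_norm_pochhammer_bound(1)[OF a x[OF that]] .
  have "(\<lambda>p. norm (f p)) summable_on D \<times> UNIV"
  proof (rule summable_on_SigmaI)
    fix i assume i: "i \<in> D"
    have "(\<lambda>k. norm (w i) * norm (a k * x i ^ k)) sums (norm (w i) * (\<Sum>k. norm (a k * x i ^ k)))"
      using sm[OF i] by (intro sums_mult summable_sums)
    thus "((\<lambda>k. norm (f (i, k))) has_sum norm (w i) * (\<Sum>k. norm (a k * x i ^ k))) UNIV"
      unfolding f_def by (intro sums_nonneg_imp_has_sum) (auto simp: norm_mult)
  next
    have "(\<lambda>i. norm (norm (w i) * (\<Sum>k. norm (a k * x i ^ k)))) summable_on D"
    proof (rule Infinite_Sum.abs_summable_on_comparison_test')
      show "(\<lambda>i. C * (norm (w i) * (1 - norm (x i)) powr (- \<tau>))) summable_on D"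
        using w by (rule summable_on_cmult_right)
      fix i assume i: "i \<in> D"
      have "norm (w i) * (\<Sum>k. norm (a k * x i ^ k)) \<le> norm (w i) * (C * (1 - norm (x i)) powr (- \<tau>))"
        by (intro mult_left_mono summable_norm_pochhammer_bound(2)[OF a x[OF i]]) auto
      moreover have "(\<Sum>k. norm (a k * x i ^ k)) \<ge> 0"
        by (intro suminf_nonneg sm i) auto
      ultimately show "norm (norm (w i) * (\<Sum>k. norm (a k * x i ^ k))) \<le>
          C * (norm (w i) * (1 - norm (x i)) powr (- \<tau>))"
        by (simp add: abs_mult mult_ac)
    qed
    thus "(\<lambda>i. norm (w i) * (\<Sum>k. norm (a k * x i ^ k))) summable_on D"
      by (rule abs_summable_summable)
  qed auto
  hence f: "f summable_on D \<times> UNIV" by (rule abs_summable_summable)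
  then obtain S where S: "(f has_sum S) (D \<times> UNIV)" by (auto simp: summable_on_def)
  have inner: "((\<lambda>k. f (i, k)) has_sum w i * (\<Sum>k. a k * x i ^ k)) UNIV" if "i \<in> D" for i
    unfolding f_def case_prod_conv
    by (intro has_sum_cmult_right norm_summable_imp_has_sum summable_sums sm that summable_norm_cancel)
  \<comment> \<open>The total \<open>S\<close> is evaluated with the inner sum over \<open>k\<close>
    here, and with the inner sum over \<open>i\<close> below.\<close>
  have 1: "((\<lambda>i. w i * (\<Sum>k. a k * x i ^ k)) has_sum S) D"
    using S inner by (rule has_sum_SigmaD)
  show "(\<lambda>i. w i * (\<Sum>k. a k * x i ^ k)) summable_on D"
    using 1 by (auto simp: summable_on_def)
  have S': "((\<lambda>(k, i). f (i, k)) has_sum S) (UNIV \<times> D)"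
    using S by (subst has_sum_swap) simp
  have inner': "((\<lambda>i. case (k, i) of (k, i) \<Rightarrow> f (i, k)) has_sum a k * (\<Sum>\<^sub>\<infinity>i\<in>D. w i * x i ^ k)) D" for k
  proof -
    have "(\<lambda>(k, i). f (i, k)) summable_on UNIV \<times> D"
      using S' by (auto simp: summable_on_def)
    hence "(\<lambda>i. f (i, k)) summable_on D" by (rule summable_on_SigmaD1) simp
    hence "((\<lambda>i. f (i, k)) has_sum (\<Sum>\<^sub>\<infinity>i\<in>D. f (i, k))) D" by (rule has_sum_infsum)
    also have "(\<Sum>\<^sub>\<infinity>i\<in>D. f (i, k)) = (\<Sum>\<^sub>\<infinity>i\<in>D. a k * (w i * x i ^ k))"
      by (simp add: f_def mult_ac)
    also have "\<dots> = a k * (\<Sum>\<^sub>\<infinity>i\<in>D. w i * x i ^ k)" by (rule infsum_cmult_right')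
    finally show ?thesis by simp
  qed
  have "((\<lambda>k. a k * (\<Sum>\<^sub>\<infinity>i\<in>D. w i * x i ^ k)) has_sum S) UNIV"
    using S' inner' by (rule has_sum_SigmaD)
  hence "(\<lambda>k. a k * (\<Sum>\<^sub>\<infinity>i\<in>D. w i * x i ^ k)) sums S" by (rule has_sum_imp_sums)
  thus "(\<lambda>k. a k * (\<Sum>\<^sub>\<infinity>i\<in>D. w i * x i ^ k)) sums (\<Sum>\<^sub>\<infinity>i\<in>D. w i * (\<Sum>k. a k * x i ^ k))"
    using infsumI[OF 1] by simp
qed

section \<open>Zeta products and double zeta values as sums over pairs\<close>

definition increasing_pairs :: "(nat \<times> nat) set" where
  "increasing_pairs = {(m, n). 0 < m \<and> m < n}"

lemma summable_on_nat_powr: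
  assumes "Re s > 1"
  shows "(\<lambda>n::nat. norm (of_nat n powr (- s) :: complex)) summable_on {1..}"
proof -
  have "summable (\<lambda>n::nat. real n powr (- Re s))" using assms by (simp add: summable_real_powr_iff)
  hence "(\<lambda>n::nat. real n powr (- Re s)) summable_on UNIV"
    by (intro summable_nonneg_imp_summable_on) auto
  hence "(\<lambda>n::nat. real n powr (- Re s)) summable_on {1..}"
    by (rule summable_on_subset_banach) auto
  thus ?thesis by (simp add: norm_powr_real_powr)
qed

text \<open>The substitution \<open>n = m + l\<close> carries the product of the two Dirichlet
  series to increasing pairs. The norm version serves as the majorant for both interchanges
  below.\<close>

lemma zeta_mult:
  assumes "Re s > 1" "Re t > 1"
  shows "(\<lambda>(m, n). norm (of_nat m powr (- s) * of_nat (n - m) powr (- t) :: complex)) summable_on increasing_pairs"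
    and "(\<Sum>\<^sub>\<infinity>(m, n)\<in>increasing_pairs. of_nat m powr (- s) * of_nat (n - m) powr (- t)) = zeta s * zeta t"
proof -
  let ?A = "{1::nat..}"
  define f where "f = (\<lambda>(m, l). (of_nat m powr (- s) * of_nat l powr (- t) :: complex))"
  define g where "g = (\<lambda>(m, n). (of_nat m powr (- s) * of_nat (n - m) powr (- t) :: complex))"
  have abs: "(\<lambda>p. norm (f p)) summable_on ?A \<times> ?A"
  proof (rule summable_on_SigmaI)
    fix m :: nat
    show "((\<lambda>l. norm (f (m, l))) has_sum norm (of_nat m powr (- s) :: complex) *
        (\<Sum>\<^sub>\<infinity>l\<in>?A. norm (of_nat l powr (- t) :: complex))) ?A"
      unfolding f_def case_prod_conv norm_mult
      by (intro has_sum_cmult_right has_sum_infsum summable_on_nat_powr assms)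
    show "(\<lambda>m. norm (of_nat m powr (- s) :: complex) *
        (\<Sum>\<^sub>\<infinity>l\<in>?A. norm (of_nat l powr (- t) :: complex))) summable_on ?A"
      by (intro summable_on_cmult_left summable_on_nat_powr assms)
  qed auto
  have eq: "norm (f p) = norm (g (fst p, fst p + snd p))" "f p = g (fst p, fst p + snd p)" for p
    by (simp_all add: f_def g_def split: prod.splits)
  have bij: "bij_betw (\<lambda>p. (fst p, fst p + snd p)) (?A \<times> ?A) increasing_pairs"
    by (rule bij_betwI[where g = "\<lambda>p. (fst p, snd p - fst p)"]) (auto simp: increasing_pairs_def)
  from abs have "(\<lambda>p. norm (g p)) summable_on increasing_pairs"
    unfolding eq(1) using summable_on_reindex_bij_betw[OF bij, of "\<lambda>p. norm (g p)"] by simp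
  thus "(\<lambda>(m, n). norm (of_nat m powr (- s) * of_nat (n - m) powr (- t) :: complex)) summable_on increasing_pairs"
    by (simp add: g_def case_prod_unfold)
  have "infsum g increasing_pairs = infsum f (?A \<times> ?A)"
    unfolding eq(2)[abs_def] using infsum_reindex_bij_betw[OF bij, of g] by simp
  also have "\<dots> = (\<Sum>\<^sub>\<infinity>m\<in>?A. \<Sum>\<^sub>\<infinity>l\<in>?A. f (m, l))"
    using infsum_Sigma_banach[OF abs_summable_summable[OF abs]] by simp
  also have "\<dots> = zeta s * zeta t"
    by (simp add: f_def zeta_def infsum_cmult_right' infsum_cmult_left')
  finally show "(\<Sum>\<^sub>\<infinity>(m, n)\<in>increasing_pairs. of_nat m powr (- s) * of_nat (n - m) powr (- t)) = zeta s * zeta t"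
    by (simp add: g_def)
qed


text \<open>The shift by \<open>k\<close> moves into the factor \<open>(m/n) ^ k\<close>, so a sum
  over \<open>k\<close> becomes a power series in \<open>m/n\<close> under the sum over
  pairs.\<close>

lemma zeta2_shift:
  "zeta2 (s - of_nat k) (t + of_nat k) =
     (\<Sum>\<^sub>\<infinity>p\<in>increasing_pairs. of_nat (fst p) powr (- s) * of_nat (snd p) powr (- t) * (of_nat (fst p) / of_nat (snd p)) ^ k)"
  unfolding zeta2_def increasing_pairs_def[symmetric] unfolding case_prod_unfold
proof (rule infsum_cong)
  fix p :: "nat \<times> nat" assume "p \<in> increasing_pairs"
  hence "fst p \<noteq> 0" "snd p \<noteq> 0" by (auto simp: increasing_pairs_def)
  thus "of_nat (fst p) powr - (s - of_nat k) * of_nat (snd p) powr - (t + of_nat k) =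
      of_nat (fst p) powr (- s) * of_nat (snd p) powr (- t) * (of_nat (fst p) / of_nat (snd p) :: complex) ^ k"
    by (simp add: powr_diff powr_minus powr_add powr_nat' power_divide field_simps)
qed

text \<open>Both bases are nonnegative reals, where principal powers are multiplicative.\<close>

lemma powr_mult_one_minus_quotient:
  assumes "m < n"
  shows "of_nat n powr z * (1 - of_nat m / of_nat n) powr z = (of_nat (n - m) powr z :: complex)"
proof -
  have "1 - of_nat m / of_nat n = complex_of_real (1 - real m / real n)" by simp
  hence "of_nat n powr z * (1 - of_nat m / of_nat n) powr z =
      (of_nat n * (1 - of_nat m / of_nat n) :: complex) powr z"
    using assms by (subst powr_times_real) auto
  also have "of_nat n * (1 - of_nat m / of_nat n) = (of_nat (n - m) :: complex)"
    using assms by (simp add: field_simps of_nat_diff)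
  finally show ?thesis .
qed

lemma norm_quotient_increasing_pairs:
  assumes "p \<in> increasing_pairs"
  shows "norm (of_nat (fst p) / of_nat (snd p) :: complex) < 1"
  using assms by (auto simp: increasing_pairs_def norm_divide)

lemma norm_one_minus_quotient_powr:
  assumes "m < n"
  shows "(1 - norm (of_nat m / of_nat n :: complex)) powr Re z = norm ((1 - of_nat m / of_nat n :: complex) powr z)"
proof -
  have eq: "(1 - of_nat m / of_nat n :: complex) = of_real (1 - real m / real n)" by simp
  show ?thesis unfolding eq using assms by (subst norm_powr_real_powr) (auto simp: norm_divide)
qed

section \<open>Evaluation of the two kinds of terms\<close>

lemma cbinomial_rising:
  assumes "Re t > 0"
  shows "cbinomial (t + of_nat k - 1) (of_nat k) = pochhammer t k / fact k"
proof -
  have "t \<notin> \<int>\<^sub>\<le>\<^sub>0" using assms by (rule Re_pos_imp_not_nonpos_Int)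
  thus ?thesis by (simp add: cbinomial_def pochhammer_Gamma Gamma_fact add.commute[of _ 1])
qed

lemma cbinomial_incbeta_coeff:
  "cbinomial (s + t + of_nat k - 1) (s + of_nat k) = incbeta_coeff s t k"
  by (simp add: cbinomial_def incbeta_coeff_def)

text \<open>After the interchange the inner series is \<open>(1 - m/n) powr (- t)\<close>, which
  turns \<open>n powr (- t)\<close> into \<open>(n - m) powr (- t)\<close>. The summability required
  is the absolute convergence of the product of zeta series.\<close>

lemma sums_cbinomial_zeta2:
  assumes "Re s > 1" "Re t > 1"
  shows "(\<lambda>k. cbinomial (t + of_nat k - 1) (of_nat k) * zeta2 (s - of_nat k) (t + of_nat k)) sums (zeta s * zeta t)"
proof -
  have t: "Re t > 0" using assms by simp
  let ?x = "\<lambda>p. of_nat (fst p) / of_nat (snd p) :: complex"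
  let ?w = "\<lambda>p. of_nat (fst p) powr (- s) * of_nat (snd p) powr (- t) :: complex"
  obtain C where C: "\<And>k. norm (pochhammer t k) \<le> C * pochhammer (Re t) k"
    using pochhammer_norm_le[OF t] by blast
  have w: "?w p * (1 - ?x p) powr (- t) = of_nat (fst p) powr (- s) * of_nat (snd p - fst p) powr (- t)"
    if "p \<in> increasing_pairs" for p
    using that by (auto simp: increasing_pairs_def mult.assoc powr_mult_one_minus_quotient)
  have "(\<lambda>k. pochhammer t k / fact k * (\<Sum>\<^sub>\<infinity>p\<in>increasing_pairs. ?w p * ?x p ^ k)) sums
      (\<Sum>\<^sub>\<infinity>p\<in>increasing_pairs. ?w p * (\<Sum>k. pochhammer t k / fact k * ?x p ^ k))"
  proof (rule sums_power_series_interchange(2))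
    show "norm (pochhammer t k / fact k) \<le> C * (pochhammer (Re t) k / fact k)" for k
      using divide_right_mono[OF C[of k], of "fact k"] by (simp add: norm_divide)
    have "norm (?w p) * (1 - norm (?x p)) powr (- Re t) =
        norm (of_nat (fst p) powr (- s) * of_nat (snd p - fst p) powr (- t) :: complex)"
      if p: "p \<in> increasing_pairs" for p
      unfolding w[OF p, symmetric] norm_mult using p norm_one_minus_quotient_powr[of "fst p" "snd p" "- t"]
      by (simp add: increasing_pairs_def case_prod_unfold)
    thus "(\<lambda>p. norm (?w p) * (1 - norm (?x p)) powr (- Re t)) summable_on increasing_pairs"
      using zeta_mult(1)[OF assms] by (simp add: case_prod_unfold cong: summable_on_cong)
  qed (rule norm_quotient_increasing_pairs)
  also have "(\<Sum>\<^sub>\<infinity>p\<in>increasing_pairs. ?w p * (\<Sum>k. pochhammer t k / fact k * ?x p ^ k)) =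
      (\<Sum>\<^sub>\<infinity>p\<in>increasing_pairs. of_nat (fst p) powr (- s) * of_nat (snd p - fst p) powr (- t))"
  proof (rule infsum_cong)
    fix p assume p: "p \<in> increasing_pairs"
    show "?w p * (\<Sum>k. pochhammer t k / fact k * ?x p ^ k) =
        of_nat (fst p) powr (- s) * of_nat (snd p - fst p) powr (- t)"
      using w[OF p] sums_unique[OF pochhammer_series_sums_complex[OF norm_quotient_increasing_pairs[OF p]], of t]
      by simp
  qed
  also have "\<dots> = zeta s * zeta t" using zeta_mult(2)[OF assms] by (simp add: case_prod_unfold)
  finally show ?thesis by (simp add: zeta2_shift cbinomial_rising[OF t])
qed

lemma sums_incbeta_coeff_zeta2:
  assumes "Re s > 1" "Re t > 1"
  defines "f \<equiv> \<lambda>p. of_nat (snd p) powr (- (s + t)) * incbeta_series s t (of_nat (fst p) / of_nat (snd p))"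
  shows "f summable_on increasing_pairs"
    and "(\<lambda>k. cbinomial (s + t + of_nat k - 1) (s + of_nat k) * zeta2 (- of_nat k) (s + t + of_nat k)) sums
      infsum f increasing_pairs"
proof -
  have st: "Re s > 0" "Re t > 0" using assms by simp_all
  let ?x = "\<lambda>p. of_nat (fst p) / of_nat (snd p) :: complex"
  let ?w = "\<lambda>p. of_nat (snd p) powr (- (s + t)) :: complex"
  obtain C where C: "\<And>k. norm (incbeta_coeff s t k) \<le> C * (pochhammer (Re t) k / fact k)"
    using incbeta_coeff_bound[OF st] by blast
  have "(\<lambda>p. norm (norm (?w p) * (1 - norm (?x p)) powr (- Re t))) summable_on increasing_pairs"
  proof (rule Infinite_Sum.abs_summable_on_comparison_test')
    show "(\<lambda>p. norm (of_nat (fst p) powr (- s) * of_nat (snd p - fst p) powr (- t) :: complex)) summable_on increasing_pairs"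
      using zeta_mult(1)[OF assms(1,2)] by (simp add: case_prod_unfold)
    fix p assume p: "p \<in> increasing_pairs"
    hence less: "0 < fst p" "fst p < snd p" by (auto simp: increasing_pairs_def)
    have "norm (?w p) * (1 - norm (?x p)) powr (- Re t) =
        norm (of_nat (snd p) powr (- s) * (of_nat (snd p) powr (- t) * (1 - ?x p) powr (- t)))"
      using norm_one_minus_quotient_powr[OF less(2), of "- t"] less
      by (simp add: norm_mult powr_diff powr_minus norm_divide norm_inverse field_simps)
    also have "\<dots> = norm (of_nat (snd p) powr (- s) :: complex) * norm (of_nat (snd p - fst p) powr (- t) :: complex)"
      unfolding powr_mult_one_minus_quotient[OF less(2)] by (rule norm_mult)
    \<comment> \<open>Since \<open>m < n\<close> and \<open>Re s > 0\<close>, passing from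
      \<open>n\<close> to \<open>m\<close> in the first factor enlarges it and reaches the majorant
      from \<open>zeta_mult\<close>.\<close>
    also have "\<dots> \<le> norm (of_nat (fst p) powr (- s) :: complex) * norm (of_nat (snd p - fst p) powr (- t) :: complex)"
      using less st by (intro mult_right_mono) (auto simp: norm_powr_real_powr intro!: powr_mono2')
    finally show "norm (norm (?w p) * (1 - norm (?x p)) powr (- Re t)) \<le>
        norm (of_nat (fst p) powr (- s) * of_nat (snd p - fst p) powr (- t) :: complex)"
      by (simp add: norm_mult)
  qed
  hence "(\<lambda>p. norm (?w p) * (1 - norm (?x p)) powr (- Re t)) summable_on increasing_pairs"
    by (rule abs_summable_summable)
  note * = sums_power_series_interchange[OF C norm_quotient_increasing_pairs this]
  show "f summable_on increasing_pairs"
    using *(1) by (simp add: f_def incbeta_series_def)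
  have "zeta2 (- of_nat k) (s + t + of_nat k) = (\<Sum>\<^sub>\<infinity>p\<in>increasing_pairs. ?w p * ?x p ^ k)" for k
  proof -
    have "zeta2 (- of_nat k) (s + t + of_nat k) =
        (\<Sum>\<^sub>\<infinity>p\<in>increasing_pairs. of_nat (fst p) powr (- 0) * ?w p * ?x p ^ k)"
      using zeta2_shift[of 0 k "s + t"] by simp
    \<comment> \<open>Here \<open>0 < m\<close> matters: \<open>m powr 0\<close> is 1 for
      \<open>m > 0\<close>, but \<open>0 powr 0\<close> is 0.\<close>
    also have "\<dots> = (\<Sum>\<^sub>\<infinity>p\<in>increasing_pairs. ?w p * ?x p ^ k)"
      by (rule infsum_cong) (auto simp: increasing_pairs_def)
    finally show ?thesis .
  qed
  thus "(\<lambda>k. cbinomial (s + t + of_nat k - 1) (s + of_nat k) * zeta2 (- of_nat k) (s + t + of_nat k)) sums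
      infsum f increasing_pairs"
    using *(2) by (simp add: cbinomial_incbeta_coeff f_def incbeta_series_def)
qed

text \<open>The involution sending \<open>m\<close> to \<open>n - m\<close> changes
  \<open>m/n\<close> into \<open>1 - m/n\<close> in the second sum, so the reflection formula
  applies termwise. The factor \<open>n powr (- (s + t))\<close> then clears the denominators,
  leaving the summand of \<open>zeta_mult\<close>.\<close>

lemma infsum_incbeta_series_add:
  assumes "Re s > 1" "Re t > 1"
  shows "(\<Sum>\<^sub>\<infinity>p\<in>increasing_pairs. of_nat (snd p) powr (- (s + t)) * incbeta_series s t (of_nat (fst p) / of_nat (snd p))) +
    (\<Sum>\<^sub>\<infinity>p\<in>increasing_pairs. of_nat (snd p) powr (- (t + s)) * incbeta_series t s (of_nat (fst p) / of_nat (snd p)))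
    = zeta s * zeta t" (is "infsum ?f _ + infsum ?g _ = _")
proof -
  let ?h = "\<lambda>p. (snd p - fst p, snd p)"
  have bij: "bij_betw ?h increasing_pairs increasing_pairs"
    by (rule bij_betwI[where g = ?h]) (auto simp: increasing_pairs_def)
  have g: "(\<lambda>p. ?g (?h p)) summable_on increasing_pairs"
    using sums_incbeta_coeff_zeta2(1)[OF assms(2,1)] by (subst summable_on_reindex_bij_betw[OF bij])
  have "infsum ?f increasing_pairs + infsum ?g increasing_pairs =
      infsum ?f increasing_pairs + infsum (\<lambda>p. ?g (?h p)) increasing_pairs"
    using infsum_reindex_bij_betw[OF bij, of ?g] by simp
  also have "\<dots> = (\<Sum>\<^sub>\<infinity>p\<in>increasing_pairs. ?f p + ?g (?h p))"
    by (rule infsum_add[symmetric, OF sums_incbeta_coeff_zeta2(1)[OF assms] g])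
  also have "\<dots> = (\<Sum>\<^sub>\<infinity>p\<in>increasing_pairs. of_nat (fst p) powr (- s) * of_nat (snd p - fst p) powr (- t))"
  proof (rule infsum_cong)
    fix p assume "p \<in> increasing_pairs"
    then obtain m n where p: "p = (m, n)" "0 < m" "m < n" by (auto simp: increasing_pairs_def)
    have x: "0 < real m / real n" "real m / real n < 1" using p by auto
    have y: "of_nat (n - m) / of_nat n = complex_of_real (1 - real m / real n)"
      using p by (simp add: of_nat_diff diff_divide_distrib)
    have "?f p + ?g (?h p) = of_nat n powr (- (s + t)) *
        (incbeta_series s t (of_real (real m / real n)) + incbeta_series t s (of_real (1 - real m / real n)))"
      unfolding p fst_conv snd_conv y by (simp add: add.commute distrib_left)
    also have "incbeta_series s t (of_real (real m / real n)) + incbeta_series t s (of_real (1 - real m / real n)) =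
        of_real (real m / real n) powr (- s) * of_real (1 - real m / real n) powr (- t)"
      using assms x by (intro incbeta_reflection) auto
    also have "of_nat n powr (- (s + t)) * (of_real (real m / real n) powr (- s) * of_real (1 - real m / real n) powr (- t)) =
       (of_nat n powr (- s) * of_real (real m / real n) powr (- s)) *
       (of_nat n powr (- t) * (1 - of_nat m / of_nat n) powr (- t) :: complex)"
      using p by (simp add: powr_diff powr_minus field_simps)
    also have "of_nat n powr (- s) * of_real (real m / real n) powr (- s) =
        (of_nat n * of_real (real m / real n) :: complex) powr (- s)"
      using x by (subst powr_times_real) auto
    also have "of_nat n * of_real (real m / real n) = (of_nat m :: complex)"
      using p by simp
    also have "of_nat n powr (- t) * (1 - of_nat m / of_nat n) powr (- t) = (of_nat (n - m) powr (- t) :: complex)"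
      using p by (intro powr_mult_one_minus_quotient)
    finally show "?f p + ?g (?h p) = of_nat (fst p) powr (- s) * of_nat (snd p - fst p) powr (- t)"
      by (simp add: p)
  qed
  also have "\<dots> = zeta s * zeta t" using zeta_mult(2)[OF assms] by (simp add: case_prod_unfold)
  finally show ?thesis .
qed

theorem proposition2p7:
  fixes s t :: complex
  assumes "Re s > 1" and "Re t > 1"
  shows
    "summable (\<lambda>k::nat.
        cbinomial (t + of_nat k - 1) (of_nat k) * zeta2 (s - of_nat k) (t + of_nat k)
        - cbinomial (s + t + of_nat k - 1) (s + of_nat k) * zeta2 (- of_nat k) (s + t + of_nat k)) \<and>
     summable (\<lambda>k::nat.
        cbinomial (s + of_nat k - 1) (of_nat k) * zeta2 (t - of_nat k) (s + of_nat k)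
        - cbinomial (s + t + of_nat k - 1) (t + of_nat k) * zeta2 (- of_nat k) (s + t + of_nat k)) \<and>
     zeta s * zeta t =
       (\<Sum>k::nat.
        cbinomial (t + of_nat k - 1) (of_nat k) * zeta2 (s - of_nat k) (t + of_nat k)
        - cbinomial (s + t + of_nat k - 1) (s + of_nat k) * zeta2 (- of_nat k) (s + t + of_nat k)) +
       (\<Sum>k::nat.
        cbinomial (s + of_nat k - 1) (of_nat k) * zeta2 (t - of_nat k) (s + of_nat k)
        - cbinomial (s + t + of_nat k - 1) (t + of_nat k) * zeta2 (- of_nat k) (s + t + of_nat k))"
proof -
  \<comment> \<open>Abstracting over \<open>s\<close> and \<open>t\<close> lets one argument serve
    both series, the second being \<open>?A t s\<close>.\<close>
  let ?A = "\<lambda>s t. \<lambda>k::nat. cbinomial (t + of_nat k - 1) (of_nat k) * zeta2 (s - of_nat k) (t + of_nat k)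
      - cbinomial (s + t + of_nat k - 1) (s + of_nat k) * zeta2 (- of_nat k) (s + t + of_nat k)"
  let ?T = "\<lambda>s t. \<Sum>\<^sub>\<infinity>p\<in>increasing_pairs. of_nat (snd p) powr (- (s + t)) *
      incbeta_series s t (of_nat (fst p) / of_nat (snd p))"
  have sums: "?A u v sums (zeta u * zeta v - ?T u v)" if "Re u > 1" "Re v > 1" for u v
    using that by (intro sums_diff sums_cbinomial_zeta2 sums_incbeta_coeff_zeta2(2))
  note st = sums[OF assms] and ts = sums[OF assms(2,1)]
  \<comment> \<open>The first binomial terms give the zeta product twice, and the two subtracted
    sums together remove it once.\<close>
  have "suminf (?A s t) + suminf (?A t s) = zeta s * zeta t"
    using infsum_incbeta_series_add[OF assms]
    by (simp only: sums_unique[OF st, symmetric] sums_unique[OF ts, symmetric])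
       (simp add: algebra_simps)
  moreover have "?A t s = (\<lambda>k. cbinomial (s + of_nat k - 1) (of_nat k) * zeta2 (t - of_nat k) (s + of_nat k)
        - cbinomial (s + t + of_nat k - 1) (t + of_nat k) * zeta2 (- of_nat k) (s + t + of_nat k))"
    by (simp add: add.commute[of t s])
  ultimately show ?thesis
    using sums_summable[OF st] sums_summable[OF ts] by simp
qed

end
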